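(* Let $X$ and $Y$ be metric spaces, $\varphi:X\to\mathbb{R}\cup\{\pm\infty\}$ a function, and $\Psi:X\rightrightarrows Y$, $\Phi:X\to\mathcal{B}(Y)$ set-valued mappings. Consider the problem $$(\mathcal{P})\qquad\min\varphi(x)\ \text{ subject to }\ x\in\mathcal{R}=\{x\in X:\Phi(x)\subseteq\Psi(x)\},$$ and let $\bar x\in\mathcal{R}$ be a local solution to $(\mathcal{P})$. Suppose that: (i) $\varphi$ is locally Lipschitz near $\bar x$, with constant $l_\varphi>0$; (ii) $(X,d)$ is metrically complete; (iii) $\Psi$ is Hausdorff upper semicontinuous on $X$ and set-covering on $X$ with constant $\alpha>0$; (iv) $\Phi$ is Lipschitz on $X$ with constant $\beta\in[0,\alpha)$. Then, for every $l\ge\frac{l_\varphi}{\alpha-\beta}$, the penalty functional $$\varphi_l(x)=\varphi(x)+l\cdot\operatorname{exc}(\Phi(x),\Psi(x)),\qquad x\in X,$$ is exact at $\bar x$, i.e. $\bar x$ is an unconstrained local minimizer of $\varphi_l$.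
   Context: Conventions: all set-valued mappings have nonempty closed values at every point of $X$. $\mathcal{B}(Y)$ is the collection of bounded subsets of $Y$, so $\Phi:X\to\mathcal{B}(Y)$ means that $\Phi$ is a set-valued mapping with bounded values. In a metric space, $\mathrm{B}(x,r)$ is the closed ball of center $x$ and radius $r$; $\operatorname{dist}(x,S)=\inf_{z\in S}d(z,x)$; $\mathrm{B}(S,r)=\{x:\operatorname{dist}(x,S)\le r\}$; $\operatorname{exc}(A,B)=\sup_{a\in A}\operatorname{dist}(a,B)$. $\bar x\in\mathcal{R}$ is a local solution to $(\mathcal{P})$ if for some $r_0>0$ one has $\varphi(x)\ge\varphi(\bar x)$ for all $x\in\mathrm{B}(\bar x,r_0)\cap\mathcal{R}$. $\varphi$ is locally Lipschitz near $\bar x$ with constant $l_\varphi$ if for some $r_\varphi>0$ it is finite on $\mathrm{B}(\bar x,r_\varphi)$ and $|\varphi(x_1)-\varphi(x_2)|\le l_\varphi d(x_1,x_2)$ for all $x_1,x_2\in\mathrm{B}(\bar x,r_\varphi)$. $\Psi$ is set-covering on $X$ with constant $\alpha>0$ if for every $x\in X$ and every $r>0$ there exists $u\in \mathrm{B}(x,r)$ such that $\mathrm{B}(\Psi(x),\alpha r)\subseteq\Psi(u)$. $\Psi$ is Hausdorff upper semicontinuous at $x_0$ if for every $\epsilon>0$ there exists $\delta>0$ such that $\Psi(x)\subseteq\mathrm{B}(\Psi(x_0),\epsilon)$ for every $x\in\mathrm{B}(x_0,\delta)$; on $X$ if at every $x_0\in X$. $\Phi$ is Lipschitz on $X$ with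 constant $\beta$ if $\operatorname{exc}(\Phi(x_1),\Phi(x_2))\le\beta\, d(x_1,x_2)$ for all $x_1,x_2\in X$. *)

theory Defs
  imports "HOL-Analysis.Analysis"
begin

text \<open>A set-valued mapping is a function into sets. The distance to a set is the library's
  \<open>infdist\<close>; since \<open>infdist x {} = 0\<close>, the notions below have their usual meaning only for
  mappings with nonempty values.\<close>

definition enlargement :: "'a::metric_space set \<Rightarrow> real \<Rightarrow> 'a set" where
  "enlargement S r = {x. infdist x S \<le> r}"

text \<open>Extended-real valued: the supremum may be infinite when \<open>A\<close> is unbounded.\<close>

definition exc :: "'a::metric_space set \<Rightarrow> 'a set \<Rightarrow> ereal" where
  "exc A B = (SUP a\<in>A. ereal (infdist a B))"

definition set_covering :: "('a::metric_space \<Rightarrow> 'b::metric_space set) \<Rightarrow> real \<Rightarrow> bool" where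
  "set_covering \<Psi> \<alpha> \<longleftrightarrow>
     (\<forall>x. \<forall>r>0. \<exists>u\<in>cball x r. enlargement (\<Psi> x) (\<alpha> * r) \<subseteq> \<Psi> u)"

definition hausdorff_usc_at :: "('a::metric_space \<Rightarrow> 'b::metric_space set) \<Rightarrow> 'a \<Rightarrow> bool" where
  "hausdorff_usc_at \<Psi> x0 \<longleftrightarrow>
     (\<forall>\<epsilon>>0. \<exists>\<delta>>0. \<forall>x\<in>cball x0 \<delta>. \<Psi> x \<subseteq> enlargement (\<Psi> x0) \<epsilon>)"

definition hausdorff_usc :: "('a::metric_space \<Rightarrow> 'b::metric_space set) \<Rightarrow> bool" where
  "hausdorff_usc \<Psi> \<longleftrightarrow> (\<forall>x0. hausdorff_usc_at \<Psi> x0)"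

definition set_lipschitz :: "('a::metric_space \<Rightarrow> 'b::metric_space set) \<Rightarrow> real \<Rightarrow> bool" where
  "set_lipschitz \<Phi> \<beta> \<longleftrightarrow> (\<forall>x1 x2. exc (\<Phi> x1) (\<Phi> x2) \<le> ereal (\<beta> * dist x1 x2))"

definition locally_lipschitz_near :: "('a::metric_space \<Rightarrow> ereal) \<Rightarrow> 'a \<Rightarrow> real \<Rightarrow> bool" where
  "locally_lipschitz_near \<phi> x l \<longleftrightarrow>
     (\<exists>r>0. (\<forall>y\<in>cball x r. \<bar>\<phi> y\<bar> \<noteq> \<infinity>) \<and>
            (\<forall>x1\<in>cball x r. \<forall>x2\<in>cball x r. \<bar>\<phi> x1 - \<phi> x2\<bar> \<le> ereal (l * dist x1 x2)))"

definition feasible_set :: "('a \<Rightarrow> 'b set) \<Rightarrow> ('a \<Rightarrow> 'b set) \<Rightarrow> 'a set" where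
  "feasible_set \<Phi> \<Psi> = {x. \<Phi> x \<subseteq> \<Psi> x}"

text \<open>Local solution of minimizing \<open>f\<close> subject to \<open>x \<in> R\<close>; an unconstrained local minimizer
  is the case \<open>R = UNIV\<close>.\<close>

definition local_solution :: "('a::metric_space \<Rightarrow> ereal) \<Rightarrow> 'a set \<Rightarrow> 'a \<Rightarrow> bool" where
  "local_solution f R x \<longleftrightarrow> x \<in> R \<and> (\<exists>r>0. \<forall>y\<in>cball x r \<inter> R. f y \<ge> f x)"

definition penalty ::
  "('a \<Rightarrow> ereal) \<Rightarrow> ('a \<Rightarrow> 'b::metric_space set) \<Rightarrow> ('a \<Rightarrow> 'b set) \<Rightarrow> real \<Rightarrow> 'a \<Rightarrow> ereal" where
  "penalty \<phi> \<Phi> \<Psi> l x = \<phi> x + ereal l * exc (\<Phi> x) (\<Psi> x)"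

end

theory Submission
  imports Defs
begin

text \<open>The heart of the argument is a global error bound: if the values of \<open>\<Phi>\<close> at \<open>x\<close> exceed those of
  \<open>\<Psi>\<close> by at most \<open>c\<close>, then some feasible \<open>z\<close> has \<open>dist x z \<le> c / (\<alpha> - \<beta>)\<close> (lemma
  \<open>feasible_error_bound\<close>). It is obtained by an iteration of Picard type. By
  set-covering one can move from \<open>x\<close> by at most \<open>c / \<alpha>\<close> to a point \<open>u\<close> with \<open>\<Phi> x \<subseteq> \<Psi> u\<close>; since
  \<open>\<Phi>\<close> is Lipschitz, the excess at \<open>u\<close> is then at most \<open>(\<beta> / \<alpha>) * c\<close>. The steps are therefore
  dominated by a geometric series with sum \<open>c / (\<alpha> - \<beta>)\<close>, and by completeness the iterates
  converge. Upper semicontinuity of \<open>\<Psi>\<close> and closedness of its values make the limit feasible.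

  Now let \<open>x\<close> be within \<open>\<delta>\<close> of \<open>xbar\<close>, with \<open>\<delta>\<close> small. The excess at \<open>x\<close> need not be small, because \<open>\<Psi>\<close> may shrink
  abruptly near \<open>xbar\<close>. If it exceeds \<open>(\<alpha> - \<beta>) * \<delta>\<close>, the penalty term alone outweighs the possible
  decrease \<open>l\<^sub>\<phi> * \<delta>\<close> of \<open>\<phi>\<close>. Otherwise the error bound yields a feasible \<open>z\<close> within \<open>2 * \<delta>\<close> of
  \<open>xbar\<close>, and \<open>\<phi> xbar \<le> \<phi> z \<le> \<phi> x + l\<^sub>\<phi> * dist x z\<close>, where the last term is dominated by the
  penalty. The error bound holds without any loss in the constant, so the borderline value
  \<open>l = l\<^sub>\<phi> / (\<alpha> - \<beta>)\<close> is covered.\<close>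

section \<open>Excess and enlargements\<close>

lemma exc_le_iff: "exc A B \<le> ereal c \<longleftrightarrow> A \<subseteq> enlargement B c"
  by (auto simp: exc_def enlargement_def SUP_le_iff)

lemma exc_nonneg: "A \<noteq> {} \<Longrightarrow> 0 \<le> exc A B"
  unfolding exc_def by (force intro: SUP_upper2 simp: infdist_nonneg)

lemma exc_eq_0_of_subset:
  assumes "A \<noteq> {}" "A \<subseteq> B"
  shows "exc A B = 0"
proof -
  have "exc A B \<le> ereal 0"
    using assms(2) by (subst exc_le_iff) (auto simp: enlargement_def)
  then show ?thesis using exc_nonneg[OF assms(1), of B] by (simp add: zero_ereal_def)
qed

lemma subset_of_subset_enlargement_0:
  assumes "closed B" "B \<noteq> {}" "A \<subseteq> enlargement B 0"
  shows "A \<subseteq> B"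
proof
  fix a assume "a \<in> A"
  then have "infdist a B \<le> 0" using assms(3) by (auto simp: enlargement_def)
  then have "infdist a B = 0" using infdist_nonneg[of a B] by linarith
  then show "a \<in> B" using assms(1,2) by (simp add: in_closed_iff_infdist_zero)
qed

lemma infdist_le_infdist_plus:
  assumes "A \<noteq> {}" "A \<subseteq> enlargement B e"
  shows "infdist x B \<le> infdist x A + e"
proof -
  have "infdist x B - e \<le> dist x a" if "a \<in> A" for a
    using infdist_triangle[of x B a] that assms(2) by (auto simp: enlargement_def)
  then have "infdist x B - e \<le> infdist x A"
    unfolding infdist_notempty[OF assms(1)] using assms(1) by (intro cINF_greatest) auto
  then show ?thesis by simp
qed

section \<open>Error bound for the feasible set\<close>

text \<open>A complete-space version of summing a geometric series: steps \<open>(1 - q) * K * q^n\<close>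
  lead to a limit at distance at most \<open>K\<close> from the starting point.\<close>
lemma geometric_steps_converge:
  fixes f :: "nat \<Rightarrow> 'a::metric_space"
  assumes compl: "complete (UNIV :: 'a set)"
    and q: "0 \<le> q" "q < 1" and K: "0 \<le> K"
    and step: "\<And>n. dist (f n) (f (Suc n)) \<le> (1 - q) * K * q ^ n"
  obtains z where "f \<longlonglongrightarrow> z" "dist (f 0) z \<le> K"
proof -
  have d: "dist (f n) (f (n + k)) \<le> K * q ^ n * (1 - q ^ k)" for n k
  proof (induction k)
    case 0
    show ?case by simp
  next
    case (Suc k)
    have "dist (f n) (f (n + Suc k)) \<le> dist (f n) (f (n + k)) + dist (f (n + k)) (f (Suc (n + k)))"
      using dist_triangle[of "f n" "f (n + Suc k)" "f (n + k)"] by simp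
    also have "\<dots> \<le> K * q ^ n * (1 - q ^ k) + (1 - q) * K * q ^ (n + k)"
      using Suc.IH step by (intro add_mono)
    also have "\<dots> = K * q ^ n * (1 - q ^ Suc k)"
      by (simp add: algebra_simps power_add)
    finally show ?case .
  qed
  have dK: "dist (f n) (f (n + k)) \<le> K * q ^ n" for n k
  proof -
    have "K * q ^ n * (1 - q ^ k) \<le> K * q ^ n * 1"
      using q K by (intro mult_left_mono) auto
    then show ?thesis using d[of n k] by linarith
  qed
  have lim0: "(\<lambda>n. K * q ^ n) \<longlonglongrightarrow> 0"
    using q by (intro tendsto_mult_right_zero LIMSEQ_realpow_zero)
  have "Cauchy f"
    unfolding Cauchy_altdef
  proof (intro allI impI)
    fix e :: real assume "e > 0"
    with lim0 have "\<forall>\<^sub>F n in sequentially. K * q ^ n < e"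
      by (rule order_tendstoD(2))
    then obtain M where M: "\<And>m. m \<ge> M \<Longrightarrow> K * q ^ m < e"
      by (auto simp: eventually_sequentially)
    show "\<exists>M. \<forall>m\<ge>M. \<forall>n>m. dist (f m) (f n) < e"
    proof (intro exI allI impI)
      fix m n assume "M \<le> m" "m < n"
      then show "dist (f m) (f n) < e"
        using dK[of m "n - m"] M[of m] by simp
    qed
  qed
  then obtain z where z: "f \<longlonglongrightarrow> z"
    using compl by (auto simp: complete_def)
  have "dist (f 0) z \<le> K"
  proof (rule LIMSEQ_le_const2)
    show "(\<lambda>n. dist (f 0) (f n)) \<longlonglongrightarrow> dist (f 0) z"
      using z by (intro tendsto_intros)
    show "\<exists>N. \<forall>n\<ge>N. dist (f 0) (f n) \<le> K"
      using dK[of 0] by auto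
  qed
  with z show thesis by (rule that)
qed

lemma set_lipschitz_subset_enlargement:
  assumes "set_lipschitz \<Phi> \<beta>"
  shows "\<Phi> x \<subseteq> enlargement (\<Phi> y) (\<beta> * dist x y)"
  using assms by (simp add: set_lipschitz_def exc_le_iff)

text \<open>One step of the iteration: the excess shrinks by the factor \<open>\<beta> / \<alpha>\<close>.\<close>
lemma covering_step:
  fixes \<Phi> \<Psi> :: "'a::metric_space \<Rightarrow> 'b::metric_space set"
  assumes \<Psi>: "\<Psi> x \<noteq> {}" "closed (\<Psi> x)" and \<Phi>: "\<Phi> x \<noteq> {}"
    and cov: "set_covering \<Psi> \<alpha>" "\<alpha> > 0"
    and lip: "set_lipschitz \<Phi> \<beta>" "0 \<le> \<beta>"
    and c: "0 \<le> c" "\<Phi> x \<subseteq> enlargement (\<Psi> x) c"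
  obtains u where "dist x u \<le> c / \<alpha>" "\<Phi> u \<subseteq> enlargement (\<Psi> u) (\<beta> / \<alpha> * c)"
proof -
  \<comment> \<open>Set-covering only speaks of positive radii; for \<open>c = 0\<close> the point \<open>x\<close> is already feasible.\<close>
  obtain u where u: "dist x u \<le> c / \<alpha>" "\<Phi> x \<subseteq> \<Psi> u"
  proof (cases "c = 0")
    case True
    then show thesis
      using that[of x] subset_of_subset_enlargement_0[OF \<Psi>(2,1)] c(2) by simp
  next
    case False
    then have "c / \<alpha> > 0" using c(1) cov(2) by simp
    then obtain u where "u \<in> cball x (c / \<alpha>)" "enlargement (\<Psi> x) (\<alpha> * (c / \<alpha>)) \<subseteq> \<Psi> u"
      using cov(1) unfolding set_covering_def by blast
    then show thesis
      using that[of u] c(2) cov(2) by auto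
  qed
  have "\<Phi> u \<subseteq> enlargement (\<Psi> u) (\<beta> / \<alpha> * c)"
  proof
    fix a assume a: "a \<in> \<Phi> u"
    have "infdist a (\<Psi> u) \<le> infdist a (\<Phi> x)"
      using u(2) \<Phi> by (rule infdist_mono)
    also have "\<dots> \<le> \<beta> * dist u x"
      using set_lipschitz_subset_enlargement[OF lip(1), of u x] a by (auto simp: enlargement_def)
    also have "\<dots> \<le> \<beta> * (c / \<alpha>)"
      using u(1) lip(2) by (intro mult_left_mono) (simp_all add: dist_commute)
    finally show "a \<in> enlargement (\<Psi> u) (\<beta> / \<alpha> * c)"
      by (simp add: enlargement_def)
  qed
  with u(1) show thesis by (rule that)
qed

text \<open>For \<open>a \<in> \<Phi> z\<close> the distance from \<open>a\<close> to \<open>\<Psi> z\<close> is estimated by passing through \<open>\<Phi> (f n)\<close> and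
  \<open>\<Psi> (f n)\<close>: the three errors come from the Lipschitz property, the vanishing excess and upper
  semicontinuity.\<close>
lemma feasible_limit:
  fixes \<Phi> \<Psi> :: "'a::metric_space \<Rightarrow> 'b::metric_space set"
  assumes \<Psi>: "\<And>x. \<Psi> x \<noteq> {}" "closed (\<Psi> z)" and \<Phi>: "\<And>x. \<Phi> x \<noteq> {}"
    and usc: "hausdorff_usc_at \<Psi> z" and lip: "set_lipschitz \<Phi> \<beta>"
    and f: "f \<longlonglongrightarrow> z" and e: "e \<longlonglongrightarrow> 0" "\<And>n. \<Phi> (f n) \<subseteq> enlargement (\<Psi> (f n)) (e n)"
  shows "z \<in> feasible_set \<Phi> \<Psi>"
proof -
  have "\<Phi> z \<subseteq> enlargement (\<Psi> z) 0"
  proof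
    fix a assume a: "a \<in> \<Phi> z"
    have "infdist a (\<Psi> z) \<le> \<epsilon>" if \<epsilon>: "\<epsilon> > 0" for \<epsilon>
    proof -
      obtain \<delta> where \<delta>: "\<delta> > 0" "\<And>x. x \<in> cball z \<delta> \<Longrightarrow> \<Psi> x \<subseteq> enlargement (\<Psi> z) \<epsilon>"
        using usc \<epsilon> unfolding hausdorff_usc_at_def by blast
      have "\<forall>\<^sub>F n in sequentially. dist (f n) z < \<delta>"
        using f \<delta>(1) by (rule tendstoD)
      then have ev: "\<forall>\<^sub>F n in sequentially. infdist a (\<Psi> z) \<le> \<beta> * dist z (f n) + e n + \<epsilon>"
      proof eventually_elim
        case (elim n)
        have "infdist a (\<Psi> z) \<le> infdist a (\<Psi> (f n)) + \<epsilon>"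
          using elim by (intro infdist_le_infdist_plus \<Psi> \<delta>(2)) (simp add: dist_commute)
        moreover have "infdist a (\<Psi> (f n)) \<le> infdist a (\<Phi> (f n)) + e n"
          by (intro infdist_le_infdist_plus \<Phi> e)
        moreover have "infdist a (\<Phi> (f n)) \<le> \<beta> * dist z (f n)"
          using set_lipschitz_subset_enlargement[OF lip, of z "f n"] a
          by (auto simp: enlargement_def)
        ultimately show ?case by linarith
      qed
      have "(\<lambda>n. \<beta> * dist z (f n) + e n + \<epsilon>) \<longlonglongrightarrow> \<beta> * dist z z + 0 + \<epsilon>"
        using f e(1) by (intro tendsto_intros)
      then show ?thesis
        using tendsto_lowerbound[OF _ ev] by simp
    qed
    then have "infdist a (\<Psi> z) \<le> 0"
      by - (rule field_le_epsilon, simp)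
    then show "a \<in> enlargement (\<Psi> z) 0" by (simp add: enlargement_def)
  qed
  then show ?thesis
    using subset_of_subset_enlargement_0[OF \<Psi>(2,1)] by (simp add: feasible_set_def)
qed

lemma feasible_error_bound:
  fixes \<Phi> \<Psi> :: "'a::metric_space \<Rightarrow> 'b::metric_space set"
  assumes \<Psi>: "\<And>x. \<Psi> x \<noteq> {}" "\<And>x. closed (\<Psi> x)" and \<Phi>: "\<And>x. \<Phi> x \<noteq> {}"
    and compl: "complete (UNIV :: 'a set)" and usc: "hausdorff_usc \<Psi>"
    and cov: "set_covering \<Psi> \<alpha>"
    and lip: "set_lipschitz \<Phi> \<beta>" "0 \<le> \<beta>" "\<beta> < \<alpha>"
    and c: "0 \<le> c" "exc (\<Phi> x) (\<Psi> x) \<le> ereal c"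
  obtains z where "z \<in> feasible_set \<Phi> \<Psi>" "dist x z \<le> c / (\<alpha> - \<beta>)"
proof -
  have \<alpha>: "\<alpha> > 0" using lip by linarith
  define q where "q = \<beta> / \<alpha>"
  have q: "0 \<le> q" "q < 1" using lip \<alpha> by (auto simp: q_def)
  \<comment> \<open>The clause for \<open>n = 0\<close> pins the starting point of the chosen sequence to \<open>x\<close>.\<close>
  have "\<exists>f. \<forall>n. (\<Phi> (f n) \<subseteq> enlargement (\<Psi> (f n)) (q ^ n * c) \<and> (n = 0 \<longrightarrow> f n = x)) \<and>
             dist (f n) (f (Suc n)) \<le> q ^ n * c / \<alpha>"
  proof (rule dependent_nat_choice)
    show "\<exists>u. \<Phi> u \<subseteq> enlargement (\<Psi> u) (q ^ 0 * c) \<and> (0 = (0::nat) \<longrightarrow> u = x)"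
      using c(2) by (auto simp: exc_le_iff)
  next
    fix v and n :: nat
    assume v: "\<Phi> v \<subseteq> enlargement (\<Psi> v) (q ^ n * c) \<and> (n = 0 \<longrightarrow> v = x)"
    obtain u where "dist v u \<le> q ^ n * c / \<alpha>"
      "\<Phi> u \<subseteq> enlargement (\<Psi> u) (\<beta> / \<alpha> * (q ^ n * c))"
      using covering_step[OF \<Psi> \<Phi> cov \<alpha> lip(1,2) mult_nonneg_nonneg[OF zero_le_power[OF q(1)] c(1)]
          conjunct1[OF v]] .
    then show "\<exists>u. (\<Phi> u \<subseteq> enlargement (\<Psi> u) (q ^ Suc n * c) \<and> (Suc n = 0 \<longrightarrow> u = x)) \<and>
        dist v u \<le> q ^ n * c / \<alpha>"
      by (auto simp: q_def mult.assoc)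
  qed
  then obtain f where f0: "f 0 = x"
    and f: "\<And>n. \<Phi> (f n) \<subseteq> enlargement (\<Psi> (f n)) (q ^ n * c)"
    and fd: "\<And>n. dist (f n) (f (Suc n)) \<le> q ^ n * c / \<alpha>"
    by blast
  have "(1 - q) * (c / (\<alpha> - \<beta>)) = c / \<alpha>"
    using \<alpha> lip by (simp add: q_def field_simps)
  then have step: "dist (f n) (f (Suc n)) \<le> (1 - q) * (c / (\<alpha> - \<beta>)) * q ^ n" for n
    using fd[of n] by (simp add: mult.commute)
  have "0 \<le> c / (\<alpha> - \<beta>)" using c(1) lip(3) by simp
  then obtain z where z: "f \<longlonglongrightarrow> z" "dist (f 0) z \<le> c / (\<alpha> - \<beta>)"
    using geometric_steps_converge[OF compl q _ step] by blast
  have "(\<lambda>n. q ^ n * c) \<longlonglongrightarrow> 0"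
    using q by (intro tendsto_mult_left_zero LIMSEQ_realpow_zero)
  then have "z \<in> feasible_set \<Phi> \<Psi>"
    using usc \<Psi> \<Phi> lip(1) z(1) f
    by (intro feasible_limit[where f = f and e = "\<lambda>n. q ^ n * c"]) (auto simp: hausdorff_usc_def)
  with z(2) show thesis unfolding f0 by (intro that)
qed

section \<open>Exactness of the penalty functional\<close>

theorem theorem3p7:
  fixes \<phi> :: "'a::metric_space \<Rightarrow> ereal"
    and \<Psi> \<Phi> :: "'a \<Rightarrow> 'b::metric_space set"
    and xbar :: 'a
    and l\<^sub>\<phi> \<alpha> \<beta> :: real
  assumes "\<And>x. \<Psi> x \<noteq> {}" and "\<And>x. closed (\<Psi> x)"
    and "\<And>x. \<Phi> x \<noteq> {}" and "\<And>x. closed (\<Phi> x)" and "\<And>x. bounded (\<Phi> x)"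
    and "local_solution \<phi> (feasible_set \<Phi> \<Psi>) xbar"
    and "l\<^sub>\<phi> > 0" and "locally_lipschitz_near \<phi> xbar l\<^sub>\<phi>"
    and "complete (UNIV :: 'a set)"
    and "hausdorff_usc \<Psi>"
    and "\<alpha> > 0" and "set_covering \<Psi> \<alpha>"
    and "0 \<le> \<beta>" and "\<beta> < \<alpha>" and "set_lipschitz \<Phi> \<beta>"
  shows "\<forall>l::real. l \<ge> l\<^sub>\<phi> / (\<alpha> - \<beta>) \<longrightarrow> local_solution (penalty \<phi> \<Phi> \<Psi> l) UNIV xbar"
proof (intro allI impI)
  fix l :: real assume l: "l \<ge> l\<^sub>\<phi> / (\<alpha> - \<beta>)"
  note ab = \<open>\<beta> < \<alpha>\<close>
  have ll: "l\<^sub>\<phi> \<le> l * (\<alpha> - \<beta>)" using l ab by (simp add: field_simps)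
  have lpos: "l > 0"
    using l ab \<open>l\<^sub>\<phi> > 0\<close> by (smt (verit) divide_pos_pos)
  obtain r0 where feas: "xbar \<in> feasible_set \<Phi> \<Psi>" and r0: "r0 > 0"
    "\<And>y. y \<in> cball xbar r0 \<Longrightarrow> y \<in> feasible_set \<Phi> \<Psi> \<Longrightarrow> \<phi> xbar \<le> \<phi> y"
    using \<open>local_solution \<phi> (feasible_set \<Phi> \<Psi>) xbar\<close> unfolding local_solution_def by blast
  obtain r1 where r1: "r1 > 0" and fin: "\<And>y. y \<in> cball xbar r1 \<Longrightarrow> \<bar>\<phi> y\<bar> \<noteq> \<infinity>"
    and lip: "\<And>y z. y \<in> cball xbar r1 \<Longrightarrow> z \<in> cball xbar r1 \<Longrightarrow>
      \<bar>\<phi> y - \<phi> z\<bar> \<le> ereal (l\<^sub>\<phi> * dist y z)"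
    using \<open>locally_lipschitz_near \<phi> xbar l\<^sub>\<phi>\<close> unfolding locally_lipschitz_near_def by meson
  have lip': "\<phi> z \<le> \<phi> y + ereal (l\<^sub>\<phi> * dist y z)"
    if "y \<in> cball xbar r1" "z \<in> cball xbar r1" for y z
    using lip[OF that] fin[OF that(1)] fin[OF that(2)]
    by (cases "\<phi> y"; cases "\<phi> z") auto
  have pen: "penalty \<phi> \<Phi> \<Psi> l xbar = \<phi> xbar"
    using exc_eq_0_of_subset[of "\<Phi> xbar" "\<Psi> xbar"] feas \<open>\<And>x. \<Phi> x \<noteq> {}\<close>
    by (simp add: penalty_def feasible_set_def)
  \<comment> \<open>Half of the radii, since the nearby feasible point is only known to lie within \<open>2 * \<delta>\<close>.\<close>
  define \<delta> where "\<delta> = min r0 r1 / 2"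
  have \<delta>: "\<delta> > 0" "2 * \<delta> \<le> r0" "2 * \<delta> \<le> r1" using r0(1) r1 by (auto simp: \<delta>_def)
  have "\<phi> xbar \<le> penalty \<phi> \<Phi> \<Psi> l x" if x: "x \<in> cball xbar \<delta>" for x
  proof -
    have dx: "dist x xbar \<le> \<delta>" using x by (simp add: dist_commute)
    have x1: "x \<in> cball xbar r1" and b1: "xbar \<in> cball xbar r1" using x \<delta> by auto
    show ?thesis
    proof (cases "exc (\<Phi> x) (\<Psi> x) \<le> ereal ((\<alpha> - \<beta>) * \<delta>)")
      case False
      have "\<phi> xbar \<le> \<phi> x + ereal (l\<^sub>\<phi> * dist x xbar)" by (rule lip'[OF x1 b1])
      also have "\<dots> \<le> \<phi> x + ereal l * ereal ((\<alpha> - \<beta>) * \<delta>)"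
      proof -
        have "l\<^sub>\<phi> * dist x xbar \<le> l * (\<alpha> - \<beta>) * \<delta>"
          using ll dx \<open>l\<^sub>\<phi> > 0\<close> by (intro mult_mono) auto
        then show ?thesis by (intro add_left_mono) (simp add: mult.assoc)
      qed
      also have "\<dots> \<le> \<phi> x + ereal l * exc (\<Phi> x) (\<Psi> x)"
        using False lpos by (intro add_left_mono ereal_mult_left_mono) auto
      finally show ?thesis by (simp add: penalty_def)
    next
      case True
      moreover have "0 \<le> exc (\<Phi> x) (\<Psi> x)" using \<open>\<And>x. \<Phi> x \<noteq> {}\<close> by (rule exc_nonneg)
      ultimately obtain c where c: "exc (\<Phi> x) (\<Psi> x) = ereal c" "0 \<le> c" "c \<le> (\<alpha> - \<beta>) * \<delta>"
        by (cases "exc (\<Phi> x) (\<Psi> x)") auto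
      obtain z where z: "z \<in> feasible_set \<Phi> \<Psi>" "dist x z \<le> c / (\<alpha> - \<beta>)"
        using feasible_error_bound[OF assms(1-3,9,10,12,15,13,14) c(2) eq_refl[OF c(1)]] .
      have "c / (\<alpha> - \<beta>) \<le> \<delta>" using c(3) ab by (simp add: field_simps)
      then have dz: "dist xbar z \<le> 2 * \<delta>"
        using z(2) dx dist_triangle[of xbar z x] by (simp add: dist_commute)
      have "\<phi> xbar \<le> \<phi> z" using r0(2) z(1) dz \<delta> by auto
      also have "\<dots> \<le> \<phi> x + ereal (l\<^sub>\<phi> * dist x z)"
        using dz \<delta> by (intro lip'[OF x1]) auto
      also have "\<dots> \<le> \<phi> x + ereal (l * c)"
      proof -
        have "l\<^sub>\<phi> * dist x z \<le> l\<^sub>\<phi> / (\<alpha> - \<beta>) * c"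
          using mult_left_mono[OF z(2), of l\<^sub>\<phi>] \<open>l\<^sub>\<phi> > 0\<close> by simp
        also have "\<dots> \<le> l * c" using l c(2) by (rule mult_right_mono)
        finally show ?thesis by (intro add_left_mono) simp
      qed
      finally show ?thesis by (simp add: penalty_def c(1))
    qed
  qed
  then show "local_solution (penalty \<phi> \<Phi> \<Psi> l) UNIV xbar"
    using \<delta>(1) unfolding local_solution_def pen by auto
qed

end
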